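(* Let $s$ be a positive integer and let $h$ be a fixed non-negative integer. Suppose that $f$ and $g$ are two arithmetical functions with absolutely convergent Cohen-Ramanujan expansions $f(n)=\sum_{r}\widehat{f}(r)c_r^{s}(n)$ and $g(n)=\sum_{k}\widehat{g}(k)c_k^{s}(n)$ respectively. Suppose that $$\sum_{r,k}\vert \widehat{f}(r)\vert\,\vert\widehat{g}(k)\vert\,(r^sk^s)^{\frac12}\,\tau_s(r^s)\,\tau_s(k^s)<\infty .$$ Then as $N$ tends to infinity, $$\sum_{n\le N} f(n)g(n+h)\sim N\sum_{r}\widehat{f}(r)\widehat{g}(r)c_r^s(h).$$
   Context: An arithmetical function is a complex-valued function on the positive integers. Sums over $r$ and $k$ run over all positive integers, and sums over $n\le N$ run over positive integers $n$. For a positive integer $s$ and integers $m,n$ not both zero, the generalized GCD $(m,n)_s$ is the largest $l^s$ (with $l$ a positive integer) dividing both $m$ and $n$. For positive integers $r,s$ and an integer $n$, the Cohen-Ramanujan sum is $c_r^s(n)=\sum_{1\le j\le r^s,\ (j,r^s)_s=1} e^{2\pi i n j/r^s}$. An arithmetical function $f$ has an (absolutely convergent) Cohen-Ramanujan expansion with coefficients $\widehat f(r)\in\mathbb{C}$ if for every positive integer $n$ the series $\sum_{r}\widehat f(r)c_r^s(n)$ converges (absolutely) to $f(n)$. $\tau_s(n)$ is the number of positive integers of the form $l^s$ ($l$ a positive integer) dividing $n$. The symbol $\sim$ denotes asymptotic equivalence in the usual sense: $A(N)\sim B(N)$ means $A(N)/B(N)\to 1$ as $N\to\infty$.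
   Formalization: When the sum of f̂(r)ĝ(r)c_r^s(h) over r is zero, the ratio defining ∼ is undefined (e.g. s=1, h=0, f=c_1, g=c_2); in that case the formal statement claims instead that the sum of f(n)g(n+h) over n≤N is o(N). *)

theory Defs
  imports Complex_Main "HOL-Analysis.Infinite_Sum" "HOL-Library.Landau_Symbols"
begin

text \<open>
  An arithmetical function is represented by a function of type
  \<^typ>\<open>nat \<Rightarrow> complex\<close> whose value at \<open>0\<close> is irrelevant; likewise for
  coefficient sequences.
\<close>

text \<open>Meaningful for \<open>s > 0\<close> and \<open>m\<close>, \<open>n\<close> not both zero; the set is then finite and contains \<open>1\<close>.\<close>

definition gen_gcd :: "nat \<Rightarrow> int \<Rightarrow> int \<Rightarrow> int" where
  "gen_gcd s m n = Max {l ^ s | l :: int. l > 0 \<and> l ^ s dvd m \<and> l ^ s dvd n}"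

definition cohen_ramanujan_sum :: "nat \<Rightarrow> nat \<Rightarrow> int \<Rightarrow> complex" where
  "cohen_ramanujan_sum s r n =
     (\<Sum>j \<in> {j :: nat. 1 \<le> j \<and> j \<le> r ^ s \<and> gen_gcd s (int j) (int (r ^ s)) = 1}.
        exp (2 * of_real pi * \<i> * of_int n * of_nat j / of_nat (r ^ s)))"

definition has_abs_cohen_ramanujan_expansion ::
    "nat \<Rightarrow> (nat \<Rightarrow> complex) \<Rightarrow> (nat \<Rightarrow> complex) \<Rightarrow> bool" where
  "has_abs_cohen_ramanujan_expansion s f fhat \<longleftrightarrow>
     (\<forall>n::nat. n > 0 \<longrightarrow>
        (\<lambda>r. norm (fhat r * cohen_ramanujan_sum s r (int n))) summable_on {1..} \<and>
        ((\<lambda>r. fhat r * cohen_ramanujan_sum s r (int n)) has_sum f n) {1..})"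

definition tau :: "nat \<Rightarrow> nat \<Rightarrow> nat" where
  "tau s n = card {m :: nat. m dvd n \<and> (\<exists>l > 0. m = l ^ s)}"

end

(*
  Expanding both f(n) and g(n + h) gives
    (1/N) sum_{n <= N} f(n) g(n + h) = sum_{r,k} fhat(r) ghat(k) M_N(r,k),
  where M_N(r,k) is the mean over n <= N of c_r(n) c_k(n + h).
  For fixed r and k, writing the sums as sums of roots of unity shows that M_N(r,k) tends to c_r(h)
  if r = k and to 0 otherwise: the mean of w^n tends to 1 if w = 1 and to 0 for every other w on
  the unit circle.
  To pass to the limit under the double sum, use the bound |c_r(n)| <= sum of d^s over the d | r
  with d^s | n. Applying Cauchy-Schwarz first over the divisors d and then over n <= N gives
    |M_N(r,k)| <= (1 + h) (r^s k^s)^(1/2) tau_s(r^s) tau_s(k^s)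
  uniformly in N >= 1, so the summability hypothesis provides exactly the dominating series.
*)
theory Submission
  imports Defs "HOL-Analysis.Analysis" "HOL-Computational_Algebra.Primes"
begin

section \<open>Cohen-Ramanujan sums as power sums of roots of unity\<close>

text \<open>For \<open>s > 0\<close>, \<open>l ^ s dvd r ^ s\<close> amounts to
  \<open>l dvd r\<close>, so the common s-th power divisors are indexed by the finite set
  \<open>T\<close>, which contains 1. Their maximum is 1 exactly when \<open>T\<close> has no other
  member.\<close>

lemma gen_gcd_eq_1_iff:
  fixes s r j :: nat
  assumes "s > 0" "r > 0"
  shows "gen_gcd s (int j) (int (r ^ s)) = 1 \<longleftrightarrow> (\<forall>l. l dvd r \<and> l ^ s dvd j \<longrightarrow> l = 1)"
proof -
  define S where "S = {l ^ s | l :: int. l > 0 \<and> l ^ s dvd int j \<and> l ^ s dvd int (r ^ s)}"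
  define T where "T = {l. l dvd r \<and> l ^ s dvd j}"
  have "S = (\<lambda>l. int (l ^ s)) ` T"
  proof (intro equalityI subsetI)
    fix x assume "x \<in> S"
    then obtain l :: int where l: "x = l ^ s" "l > 0" "l ^ s dvd int j" "l ^ s dvd int (r ^ s)"
      by (auto simp: S_def)
    define m where "m = nat l"
    have lm: "l = int m"
      using l(2) by (simp add: m_def)
    have "m ^ s dvd j" "m ^ s dvd r ^ s"
      using l(3,4) unfolding lm by (metis of_nat_dvd_iff of_nat_power)+
    thus "x \<in> (\<lambda>l. int (l ^ s)) ` T"
      using \<open>s > 0\<close> l(1) lm by (auto simp: T_def)
  next
    fix x assume "x \<in> (\<lambda>l. int (l ^ s)) ` T"
    then obtain l where l: "x = int (l ^ s)" "l dvd r" "l ^ s dvd j"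
      by (auto simp: T_def)
    have "int l > 0"
      using l(2) \<open>r > 0\<close> by (auto intro: Nat.gr0I)
    moreover have "int l ^ s dvd int j" "int l ^ s dvd int (r ^ s)"
      using l(2,3) by (metis of_nat_dvd_iff of_nat_power dvd_power_same)+
    ultimately show "x \<in> S"
      unfolding S_def using l(1) by auto
  qed
  moreover have "finite T" "1 \<in> T"
    using \<open>r > 0\<close> by (auto simp: T_def)
  moreover have "l ^ s \<le> 1 \<longleftrightarrow> l = 1" if "l \<in> T" for l
  proof -
    have "l > 0"
      using that \<open>r > 0\<close> by (auto simp: T_def intro: Nat.gr0I)
    thus ?thesis
      using \<open>s > 0\<close> by (metis le_antisym less_one linorder_not_less nat_power_eq_Suc_0_iff
          One_nat_def one_le_power power_one order_refl)
  qed
  moreover have "gen_gcd s (int j) (int (r ^ s)) = Max S"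
    by (simp add: gen_gcd_def S_def)
  moreover have "int (1 ^ s) = 1" by simp
  ultimately have "gen_gcd s (int j) (int (r ^ s)) = 1 \<longleftrightarrow> (\<forall>l\<in>T. l = 1)"
    by (subst \<open>gen_gcd _ _ _ = _\<close>, subst Max_eq_iff) (auto simp flip: of_nat_power intro!: image_eqI[of _ _ 1])
  thus ?thesis by (auto simp: T_def)
qed

text \<open>Angles are measured in full turns, so that roots of unity are the values at rationals
  and the value 1 is taken exactly at integers.\<close>

definition turn :: "real \<Rightarrow> complex" where
  "turn x = cis (2 * pi * x)"

lemma norm_turn [simp]: "norm (turn x) = 1"
  by (simp add: turn_def)

lemma turn_add: "turn (x + y) = turn x * turn y"
  by (simp add: turn_def cis_mult ring_distribs)

lemma turn_power: "turn x ^ n = turn (real n * x)"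
  by (simp only: turn_def Complex.DeMoivre mult_ac)

lemma turn_eq_1_iff: "turn x = 1 \<longleftrightarrow> x \<in> \<int>"
proof
  assume "turn x = 1"
  then obtain n :: int where "2 * pi * x = of_int (2 * n) * pi"
    by (auto simp: turn_def cis_conv_exp exp_eq_1)
  hence "x = of_int n" by simp
  thus "x \<in> \<int>" by simp
next
  assume "x \<in> \<int>"
  thus "turn x = 1"
    unfolding turn_def by (rule cis_multiple_2pi)
qed

text \<open>The index set of the Cohen-Ramanujan sum, with the GCD condition expressed through
  divisors of \<open>r\<close>. For \<open>s = 1\<close> it is the reduced residue system modulo
  \<open>r\<close>.\<close>

definition primitive_residues :: "nat \<Rightarrow> nat \<Rightarrow> nat set" where
  "primitive_residues s r = {j \<in> {1..r ^ s}. \<forall>l. l dvd r \<and> l ^ s dvd j \<longrightarrow> l = 1}"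

lemma finite_primitive_residues [simp]: "finite (primitive_residues s r)"
  by (simp add: primitive_residues_def)

text \<open>The bases of the powers have norm 1 and do not depend on \<open>n\<close>, so averaging
  over \<open>n\<close> reduces to geometric sums.\<close>

lemma cohen_ramanujan_sum_eq:
  assumes "s > 0" "r > 0"
  shows "cohen_ramanujan_sum s r (int n) =
           (\<Sum>j\<in>primitive_residues s r. turn (real j / real (r ^ s)) ^ n)"
  unfolding cohen_ramanujan_sum_def primitive_residues_def
proof (rule sum.cong)
  show "{j. 1 \<le> j \<and> j \<le> r ^ s \<and> gen_gcd s (int j) (int (r ^ s)) = 1} =
    {j \<in> {1..r ^ s}. \<forall>l. l dvd r \<and> l ^ s dvd j \<longrightarrow> l = 1}"
    using gen_gcd_eq_1_iff[OF assms] by auto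
qed (simp add: turn_power, simp add: turn_def cis_conv_exp mult_ac)

section \<open>The divisor bound for Cohen-Ramanujan sums\<close>

lemma of_nat_divide_in_Ints_iff:
  assumes "d > 0"
  shows "real n / real d \<in> \<int> \<longleftrightarrow> d dvd n"
proof
  assume "real n / real d \<in> \<int>"
  then obtain k :: int where "real n / real d = of_int k"
    by (elim Ints_cases)
  hence "real_of_int (int n) = real_of_int (k * int d)"
    using assms by (simp add: field_simps)
  hence "int n = k * int d"
    by (simp only: of_int_eq_iff)
  thus "d dvd n"
    by (metis dvd_triv_right int_dvd_int_iff)
qed (use assms in \<open>auto elim!: dvdE\<close>)

text \<open>Exchanging the roles of \<open>i\<close> and \<open>n\<close> makes this a geometric sum
  over one full period with ratio \<open>w\<close>, where \<open>w ^ d = 1\<close>. It vanishes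
  unless \<open>w = 1\<close>, that is, unless \<open>d dvd n\<close>.\<close>

lemma sum_turn_power:
  assumes "d > 0"
  shows "(\<Sum>i=1..d. turn (real i / real d) ^ n) = (if d dvd n then of_nat d else 0)"
proof -
  define w where "w = turn (real n / real d)"
  have "(\<Sum>i=1..d. turn (real i / real d) ^ n) = (\<Sum>i=1..d. w ^ i)"
    by (simp add: w_def turn_power mult_ac)
  moreover have "w = 1 \<longleftrightarrow> d dvd n"
    using assms by (simp add: w_def turn_eq_1_iff of_nat_divide_in_Ints_iff)
  moreover have "w ^ d = 1"
    using assms by (simp add: w_def turn_power turn_eq_1_iff)
  ultimately show ?thesis
    using assms by (auto simp: sum_gp)
qed

text \<open>Writing \<open>j = m ^ s * i\<close> cancels \<open>m ^ s\<close> in the fraction and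
  leaves the complete sum of roots of unity of order dividing \<open>(r div m) ^ s\<close>.\<close>

lemma sum_turn_multiples:
  assumes "r > 0" "m dvd r"
  shows "(\<Sum>j | j \<in> {1..r ^ s} \<and> m ^ s dvd j. turn (real j / real (r ^ s)) ^ n) =
           (if (r div m) ^ s dvd n then of_nat ((r div m) ^ s) else 0)"
proof -
  define d where "d = r div m"
  have r: "r = m * d" and pos: "m > 0" "d > 0"
    using assms by (auto simp: d_def elim!: dvdE)
  have "(\<Sum>j | j \<in> {1..r ^ s} \<and> m ^ s dvd j. turn (real j / real (r ^ s)) ^ n) =
          (\<Sum>i=1..d ^ s. turn (real i / real (d ^ s)) ^ n)"
    by (rule sum.reindex_bij_witness[of _ "\<lambda>i. m ^ s * i" "\<lambda>j. j div m ^ s"])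
       (use pos in \<open>auto simp: r power_mult_distrib elim!: dvdE\<close>)
  also have "\<dots> = (if d ^ s dvd n then of_nat (d ^ s) else 0)"
    using pos by (intro sum_turn_power) auto
  finally show ?thesis
    by (simp add: d_def)
qed

text \<open>Powers of distinct primes are coprime, so separate divisibility is joint divisibility.
  The exponent 1 is used as well, to see that the product divides \<open>r\<close>.\<close>

lemma prod_prime_power_dvd_iff:
  fixes S :: "nat set" and j s :: nat
  assumes "finite S" "\<And>p. p \<in> S \<Longrightarrow> prime p"
  shows "(\<Prod>S) ^ s dvd j \<longleftrightarrow> (\<forall>p\<in>S. p ^ s dvd j)"
  using assms
proof (induction S rule: finite_induct)
  case (insert p S)
  have "coprime (p ^ s) ((\<Prod>S) ^ s)"
    using insert by (auto intro!: prod_coprime_right primes_coprime)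
  hence "p ^ s * (\<Prod>S) ^ s dvd j \<longleftrightarrow> p ^ s dvd j \<and> (\<Prod>S) ^ s dvd j"
    by (meson divides_mult dvd_mult_left dvd_mult_right)
  thus ?case
    using insert by (simp add: power_mult_distrib)
qed auto

text \<open>A set of primes can be recovered from its product; this makes the divisors
  \<open>r div \<Prod>S\<close> distinct.\<close>

lemma prod_prime_dvd_iff:
  fixes S :: "nat set" 
  assumes "finite S" "\<And>p. p \<in> S \<Longrightarrow> prime p" "prime p"
  shows "p dvd \<Prod>S \<longleftrightarrow> p \<in> S"
proof -
  have "p dvd \<Prod>S \<longleftrightarrow> (\<exists>q\<in>S. p dvd q)"
    using assms by (simp add: prime_dvd_prod_iff)
  thus ?thesis
    using assms by (metis dvd_refl primes_dvd_imp_eq)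
qed

text \<open>
  Inclusion-exclusion over the primes dividing \<open>r\<close> replaces Moebius inversion: each set \<open>S\<close> of such
  primes contributes, up to sign, the term of the divisor \<open>r div \<Prod>S\<close>, and distinct \<open>S\<close> give
  distinct divisors.
\<close>

lemma norm_cohen_ramanujan_sum_le:
  assumes "s > 0" "r > 0"
  shows "norm (cohen_ramanujan_sum s r (int n)) \<le>
           (\<Sum>d | d dvd r. if d ^ s dvd n then real (d ^ s) else 0)"
proof -
  define P where "P = prime_factors r"
  define e where "e = (\<lambda>j. turn (real j / real (r ^ s)) ^ n)"
  define F where "F = (\<lambda>d. if d ^ s dvd n then real (d ^ s) else 0)"
  have P: "finite P" "\<And>p. p \<in> P \<longleftrightarrow> prime p \<and> p dvd r"
    using assms by (auto simp: P_def in_prime_factors_iff)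
  have Pdvd: "\<Prod>S dvd r" if "S \<subseteq> P" for S
  proof -
    have "\<forall>p\<in>S. p ^ 1 dvd r" using that P by auto
    thus ?thesis
      using prod_prime_power_dvd_iff[of S 1 r] finite_subset[OF that P(1)] that P(2) by auto
  qed
  have inj: "inj_on (\<lambda>S. r div \<Prod>S) (Pow P)"
  proof (rule inj_onI)
    fix S T assume ST: "S \<in> Pow P" "T \<in> Pow P" "r div \<Prod>S = r div \<Prod>T"
    hence "\<Prod>S = \<Prod>T"
      using Pdvd[of S] Pdvd[of T] assms(2) by (metis PowD dvd_div_eq_0_iff dvd_div_mult_self
          less_numeral_extra(3) mult_cancel1)
    moreover have "finite S" "finite T" "\<forall>p\<in>S \<union> T. prime p"
      using ST P by (auto intro: finite_subset)
    ultimately show "S = T"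
      using prod_prime_dvd_iff by (metis Un_iff set_eqI)
  qed
  \<comment> \<open>Any \<open>l\<close> other than 1 has a prime factor \<open>p\<close>, and
    \<open>l ^ s dvd j\<close> gives \<open>p ^ s dvd j\<close>; so testing the primes dividing
    \<open>r\<close> suffices.\<close>
  have mem: "j \<in> primitive_residues s r \<longleftrightarrow> (\<forall>p\<in>P. \<not> p ^ s dvd j)" if "j \<in> {1..r ^ s}" for j
  proof -
    have "(\<forall>l. l dvd r \<and> l ^ s dvd j \<longrightarrow> l = 1) \<longleftrightarrow> (\<forall>p\<in>P. \<not> p ^ s dvd j)"
      using P(2) by (metis dvd_power_same dvd_trans not_prime_1 prime_factor_nat)
    thus ?thesis using that by (auto simp: primitive_residues_def)
  qed
  have "cohen_ramanujan_sum s r (int n) = (\<Sum>j\<in>primitive_residues s r. e j)"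
    using cohen_ramanujan_sum_eq[OF assms] by (simp add: e_def)
  also have "\<dots> = (\<Sum>j\<in>{1..r ^ s}. (if j \<in> primitive_residues s r then 1 else 0) * e j)"
    by (rule sum.mono_neutral_cong_left) (auto simp: primitive_residues_def)
  \<comment> \<open>The product over \<open>P\<close> is the indicator of the primitive residues.
    Expanding it gives the signed sum over subsets \<open>S\<close> of \<open>P\<close>.\<close>
  also have "\<dots> = (\<Sum>j\<in>{1..r ^ s}. (\<Prod>p\<in>P. 1 - (if p ^ s dvd j then 1 else 0)) * e j)"
    using P(1) mem by (intro sum.cong) (auto simp: prod_zero_iff)
  also have "\<dots> = (\<Sum>j\<in>{1..r ^ s}. \<Sum>S\<in>Pow P. (-1) ^ card S * (if (\<Prod>S) ^ s dvd j then e j else 0))"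
  proof (rule sum.cong)
    fix j
    have "(\<Prod>p\<in>P. 1 - (if p ^ s dvd j then 1 else 0 :: complex)) * e j =
      (\<Sum>S\<in>Pow P. (-1) ^ card S * (\<Prod>p\<in>S. if p ^ s dvd j then 1 else 0) * e j)"
      by (simp add: prod_diff_conv_sum P(1) sum_distrib_right)
    also have "\<dots> = (\<Sum>S\<in>Pow P. (-1) ^ card S * (if (\<Prod>S) ^ s dvd j then e j else 0))"
    proof (rule sum.cong)
      fix S assume "S \<in> Pow P"
      hence "finite S" "\<And>p. p \<in> S \<Longrightarrow> prime p" using P by (auto intro: finite_subset)
      thus "(-1) ^ card S * (\<Prod>p\<in>S. if p ^ s dvd j then 1 else 0) * e j =
        (-1) ^ card S * (if (\<Prod>S) ^ s dvd j then e j else 0)"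
        by (auto simp: prod_prime_power_dvd_iff prod_zero_iff)
    qed auto
    finally show "(\<Prod>p\<in>P. 1 - (if p ^ s dvd j then 1 else 0 :: complex)) * e j =
       (\<Sum>S\<in>Pow P. (-1) ^ card S * (if (\<Prod>S) ^ s dvd j then e j else 0))" .
  qed auto
  also have "\<dots> = (\<Sum>S\<in>Pow P. (-1) ^ card S * (\<Sum>j\<in>{1..r ^ s}. if (\<Prod>S) ^ s dvd j then e j else 0))"
    by (subst sum.swap) (simp add: sum_distrib_left)
  also have "\<dots> = (\<Sum>S\<in>Pow P. (-1) ^ card S * of_real (F (r div \<Prod>S)))"
  proof (rule sum.cong)
    fix S assume "S \<in> Pow P"
    hence "(\<Sum>j | j \<in> {1..r ^ s} \<and> (\<Prod>S) ^ s dvd j. e j) = of_real (F (r div \<Prod>S))"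
      unfolding e_def using sum_turn_multiples[OF assms(2) Pdvd[of S]] by (auto simp: F_def)
    thus "(-1) ^ card S * (\<Sum>j\<in>{1..r ^ s}. if (\<Prod>S) ^ s dvd j then e j else 0) =
      (-1) ^ card S * of_real (F (r div \<Prod>S))"
      by (subst sum.inter_filter[symmetric]) auto
  qed auto
  \<comment> \<open>The signs have norm 1 and \<open>F\<close> is nonnegative, so the triangle
    inequality removes them. Enlarging the sum to all divisors of \<open>r\<close> then only adds
    nonnegative terms.\<close>
  finally have "norm (cohen_ramanujan_sum s r (int n)) \<le> (\<Sum>S\<in>Pow P. F (r div \<Prod>S))"
    by (auto intro!: sum_norm_le simp: norm_mult norm_power F_def)
  also have "\<dots> = sum F ((\<lambda>S. r div \<Prod>S) ` Pow P)"
    by (simp add: sum.reindex[OF inj])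
  also have "\<dots> \<le> sum F {d. d dvd r}"
  proof (rule sum_mono2)
    show "(\<lambda>S. r div \<Prod>S) ` Pow P \<subseteq> {d. d dvd r}"
      using Pdvd by (auto, metis dvd_div_mult_self dvd_triv_left)
  qed (use assms in \<open>auto simp: F_def\<close>)
  finally show ?thesis by (simp add: F_def)
qed

section \<open>Bounds for mean squares and mean products\<close>

text \<open>The map from \<open>d\<close> to \<open>d ^ s\<close> is a bijection from the divisors
  of \<open>r\<close> to the s-th powers dividing \<open>r ^ s\<close>. Thus \<open>tau\<close>
  counts the divisors that index the pointwise bound.\<close>

lemma tau_power_eq:
  assumes "s > 0" "r > 0"
  shows "tau s (r ^ s) = card {d. d dvd r}"
proof -
  have "{m. m dvd r ^ s \<and> (\<exists>l>0. m = l ^ s)} = (\<lambda>d. d ^ s) ` {d. d dvd r}"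
    using assms by (auto intro!: imageI dest: dvd_pos_nat)
  moreover have "inj_on (\<lambda>d. d ^ s) {d. d dvd r}"
    using assms(1) by (auto intro!: inj_onI simp: power_eq_iff_eq_base)
  ultimately show ?thesis
    by (simp add: tau_def card_image)
qed

text \<open>The quotient \<open>(n + h) div q\<close> determines \<open>n\<close>, and it is at
  least 1 because \<open>n + h\<close> is a positive multiple of \<open>q\<close>.\<close>

lemma card_shifted_multiples_le:
  fixes q N h :: nat
  assumes "q > 0"
  shows "card {n \<in> {1..N}. q dvd n + h} \<le> (N + h) div q"
proof -
  have "card {n \<in> {1..N}. q dvd n + h} \<le> card {1..(N + h) div q}"
  proof (rule card_inj_on_le[where f = "\<lambda>n. (n + h) div q"])
    show "inj_on (\<lambda>n. (n + h) div q) {n \<in> {1..N}. q dvd n + h}"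
      by (rule inj_onI) (metis (no_types, lifting) add_right_imp_eq dvd_div_mult_self mem_Collect_eq)
    show "(\<lambda>n. (n + h) div q) ` {n \<in> {1..N}. q dvd n + h} \<subseteq> {1..(N + h) div q}"
    proof clarify
      fix n assume n: "n \<in> {1..N}" "q dvd n + h"
      hence "(n + h) div q > 0"
        using assms by (auto simp: div_greater_zero_iff dest: dvd_imp_le)
      moreover have "(n + h) div q \<le> (N + h) div q"
        using n by (intro div_le_mono) auto
      ultimately show "(n + h) div q \<in> {1..(N + h) div q}"
        by simp
    qed
  qed auto
  thus ?thesis by simp
qed

text \<open>Cauchy-Schwarz against the constant 1 over the divisors costs one factor
  \<open>tau\<close>. Each \<open>d\<close> then contributes \<open>(d ^ s)\<close> squared at most
  \<open>(N + h) / d ^ s\<close> times, hence at most \<open>(N + h) * r ^ s\<close>; summing over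
  \<open>d\<close> gives the second factor \<open>tau\<close>.\<close>

lemma sum_norm_cohen_ramanujan_sum_square_le:
  assumes "s > 0" "r > 0"
  shows "(\<Sum>n=1..N. (norm (cohen_ramanujan_sum s r (int (n + h))))\<^sup>2)
           \<le> real (N + h) * real (r ^ s) * (real (tau s (r ^ s)))\<^sup>2"
proof -
  define D where "D = {d. d dvd r}"
  define F where "F = (\<lambda>n d. if d ^ s dvd n then real (d ^ s) else 0)"
  have [simp]: "finite D"
    using assms by (simp add: D_def)
  have pos: "d > 0" if "d \<in> D" for d
    using that assms by (auto simp: D_def intro: Nat.gr0I)
  have "(norm (cohen_ramanujan_sum s r (int n)))\<^sup>2 \<le> card D * (\<Sum>d\<in>D. (F n d)\<^sup>2)" for n
  proof -
    have "norm (cohen_ramanujan_sum s r (int n)) \<le> (\<Sum>d\<in>D. F n d)"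
      using norm_cohen_ramanujan_sum_le[OF assms] by (simp add: D_def F_def)
    hence "(norm (cohen_ramanujan_sum s r (int n)))\<^sup>2 \<le> (\<Sum>d\<in>D. 1 * F n d)\<^sup>2"
      by (simp add: power_mono)
    also have "\<dots> \<le> (\<Sum>d\<in>D. 1\<^sup>2) * (\<Sum>d\<in>D. (F n d)\<^sup>2)"
      by (rule Cauchy_Schwarz_ineq_sum)
    finally show ?thesis by simp
  qed
  hence "(\<Sum>n=1..N. (norm (cohen_ramanujan_sum s r (int (n + h))))\<^sup>2)
      \<le> (\<Sum>n=1..N. card D * (\<Sum>d\<in>D. (F (n + h) d)\<^sup>2))"
    by (intro sum_mono) blast
  also have "\<dots> = card D * (\<Sum>d\<in>D. \<Sum>n=1..N. (F (n + h) d)\<^sup>2)"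
    by (subst sum.swap) (simp add: sum_distrib_left)
  also have "\<dots> \<le> card D * (\<Sum>d\<in>D. real (N + h) * real (r ^ s))"
  proof (intro mult_left_mono sum_mono)
    fix d assume d: "d \<in> D"
    have "(\<Sum>n=1..N. (F (n + h) d)\<^sup>2) = (\<Sum>n\<in>{n\<in>{1..N}. d ^ s dvd n + h}. (real (d ^ s))\<^sup>2)"
      unfolding F_def by (subst sum.inter_filter) (auto intro!: sum.cong)
    also have "\<dots> = real (card {n\<in>{1..N}. d ^ s dvd n + h}) * (real (d ^ s))\<^sup>2"
      by simp
    also have "\<dots> \<le> (real (N + h) / real (d ^ s)) * (real (d ^ s))\<^sup>2"
    proof (rule mult_right_mono)
      have "real (card {n\<in>{1..N}. d ^ s dvd n + h}) \<le> real ((N + h) div d ^ s)"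
        using card_shifted_multiples_le[of "d ^ s" N h] pos[OF d] by simp
      also have "\<dots> \<le> real (N + h) / real (d ^ s)"
        by (rule of_nat_div_le_of_nat)
      finally show "real (card {n\<in>{1..N}. d ^ s dvd n + h}) \<le> real (N + h) / real (d ^ s)" .
    qed auto
    also have "\<dots> = real (N + h) * real (d ^ s)"
      using pos[OF d] by (simp add: power2_eq_square)
    also have "\<dots> \<le> real (N + h) * real (r ^ s)"
    proof -
      have "d \<le> r"
        using d assms by (auto simp: D_def dvd_imp_le)
      hence "real (d ^ s) \<le> real (r ^ s)"
        by (simp add: power_mono)
      thus ?thesis by (rule mult_left_mono) auto
    qed
    finally show "(\<Sum>n=1..N. (F (n + h) d)\<^sup>2) \<le> real (N + h) * real (r ^ s)" .
  qed auto
  also have "\<dots> = real (N + h) * real (r ^ s) * (real (tau s (r ^ s)))\<^sup>2"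
    using tau_power_eq[OF assms] by (simp add: D_def power2_eq_square mult_ac)
  finally show ?thesis .
qed

text \<open>Cauchy-Schwarz over \<open>n\<close> combines the two mean-square bounds, taken with
  shifts 0 and \<open>h\<close>.\<close>

lemma norm_sum_cohen_ramanujan_product_le:
  assumes "s > 0" "r > 0" "k > 0"
  shows "norm (\<Sum>n=1..N. cohen_ramanujan_sum s r (int n) * cohen_ramanujan_sum s k (int (n + h)))
           \<le> real (N + h) * (sqrt (real (r ^ s * k ^ s)) * real (tau s (r ^ s)) * real (tau s (k ^ s)))"
proof -
  define a where "a = (\<lambda>n. norm (cohen_ramanujan_sum s r (int n)))"
  define b where "b = (\<lambda>n. norm (cohen_ramanujan_sum s k (int (n + h))))"
  define t u where "t = real (tau s (r ^ s))" and "u = real (tau s (k ^ s))"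
  \<comment> \<open>The unshifted bound is weakened from \<open>N\<close> to \<open>N + h\<close>,
    so that the product of both bounds is a perfect square.\<close>
  have "(\<Sum>n=1..N. (a n)\<^sup>2) \<le> real (N + 0) * real (r ^ s) * t\<^sup>2"
    using sum_norm_cohen_ramanujan_sum_square_le[of s r 0 N] assms by (simp add: a_def t_def)
  also have "\<dots> \<le> real (N + h) * real (r ^ s) * t\<^sup>2"
    by (intro mult_right_mono) auto
  finally have a: "(\<Sum>n=1..N. (a n)\<^sup>2) \<le> real (N + h) * real (r ^ s) * t\<^sup>2" .
  have b: "(\<Sum>n=1..N. (b n)\<^sup>2) \<le> real (N + h) * real (k ^ s) * u\<^sup>2"
    using sum_norm_cohen_ramanujan_sum_square_le[of s k h N] assms by (simp add: b_def u_def)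
  have "(\<Sum>n=1..N. a n * b n)\<^sup>2 \<le> (\<Sum>n=1..N. (a n)\<^sup>2) * (\<Sum>n=1..N. (b n)\<^sup>2)"
    by (rule Cauchy_Schwarz_ineq_sum)
  also have "\<dots> \<le> (real (N + h) * real (r ^ s) * t\<^sup>2) * (real (N + h) * real (k ^ s) * u\<^sup>2)"
    using a b by (intro mult_mono) (auto intro: sum_nonneg)
  also have "\<dots> = (real (N + h) * (sqrt (real (r ^ s * k ^ s)) * t * u))\<^sup>2"
    by (simp add: power_mult_distrib power2_eq_square mult_ac)
  finally have "(\<Sum>n=1..N. a n * b n) \<le> real (N + h) * (sqrt (real (r ^ s * k ^ s)) * t * u)"
    by (rule power2_le_imp_le) (auto simp: t_def u_def)
  thus ?thesis
    by (intro order.trans[OF norm_sum]) (simp add: a_def b_def norm_mult t_def u_def)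
qed

section \<open>Mean values and orthogonality\<close>

text \<open>For \<open>w \<noteq> 1\<close> the geometric sums stay below
  \<open>2 / norm (1 - w)\<close>, so division by \<open>N\<close> sends them to 0.\<close>

lemma tendsto_mean_power:
  fixes w :: complex
  assumes "norm w = 1"
  shows "(\<lambda>N. (\<Sum>n=1..N. w ^ n) / of_nat N) \<longlonglongrightarrow> of_bool (w = 1)"
proof (cases "w = 1")
  case True
  \<comment> \<open>At \<open>N = 0\<close> the quotient is 0 by convention, so equality with 1
    starts at \<open>N = 1\<close>.\<close>
  have "eventually (\<lambda>N. (\<Sum>n=1..N. w ^ n) / of_nat N = of_bool (w = 1)) sequentially"
    using eventually_gt_at_top[of 0] by eventually_elim (simp add: True)
  thus ?thesis by (rule tendsto_eventually)
next
  case False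
  have "(\<lambda>N. (\<Sum>n=1..N. w ^ n) / of_nat N) \<longlonglongrightarrow> 0"
  proof (rule Lim_null_comparison)
    show "eventually (\<lambda>N. norm ((\<Sum>n=1..N. w ^ n) / of_nat N) \<le> (2 / norm (1 - w)) / real N) sequentially"
    proof (rule always_eventually, rule allI)
      fix N
      have "norm (\<Sum>n=1..N. w ^ n) \<le> 2 / norm (1 - w)"
      proof (cases "N = 0")
        case False
        hence "(\<Sum>n=1..N. w ^ n) = (w ^ 1 - w ^ Suc N) / (1 - w)"
          using \<open>w \<noteq> 1\<close> by (subst sum_gp) auto
        moreover have "norm (w ^ 1 - w ^ Suc N) \<le> norm (w ^ 1) + norm (w ^ Suc N)"
          by (rule norm_triangle_ineq4)
        moreover have "norm (w ^ 1) + norm (w ^ Suc N) = 2"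
          by (simp only: norm_power assms) simp
        ultimately show ?thesis
          by (simp add: norm_divide divide_right_mono)
      qed auto
      thus "norm ((\<Sum>n=1..N. w ^ n) / of_nat N) \<le> (2 / norm (1 - w)) / real N"
        unfolding norm_divide norm_of_nat by (rule divide_right_mono) simp
    qed
    show "(\<lambda>N. (2 / norm (1 - w)) / real N) \<longlonglongrightarrow> 0"
      by (rule lim_const_over_n)
  qed
  thus ?thesis using False by simp
qed

lemma turn_mult_eq_1_iff:
  assumes "r > 0" "k > 0"
  shows "turn (real a / real r) * turn (real b / real k) = 1 \<longleftrightarrow> r * k dvd a * k + b * r"
proof -
  have "turn (real a / real r) * turn (real b / real k) = turn (real (a * k + b * r) / real (r * k))"
    using assms by (simp add: add_frac_eq flip: turn_add)
  thus ?thesis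
    using assms by (simp add: turn_eq_1_iff of_nat_divide_in_Ints_iff del: of_nat_mult of_nat_add)
qed

text \<open>
  The hypothesis says that \<open>a / r ^ s + b / k ^ s\<close> is an integer. Applied in both directions, this
  forces \<open>r = k\<close>, which is the orthogonality of the sums for distinct moduli.
\<close>

lemma primitive_residues_dvd:
  assumes "s > 0" "r > 0" "k > 0" "a \<in> primitive_residues s r"
    and "r ^ s * k ^ s dvd a * k ^ s + b * r ^ s"
  shows "r dvd k"
proof -
  define g where "g = gcd r k"
  obtain r' k' where rk: "r = g * r'" "k = g * k'" "coprime r' k'"
    using gcd_coprime_exists[of r k] assms unfolding g_def by (metis gcd_eq_0_iff mult.commute neq0_conv)
  have g: "g > 0" using assms by (simp add: g_def)
  \<comment> \<open>After cancelling \<open>g ^ s\<close>, the term with \<open>b\<close> vanishes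
    modulo \<open>r' ^ s\<close> and \<open>k' ^ s\<close> is invertible there. Hence
    \<open>r' ^ s dvd a\<close>, and primitivity of \<open>a\<close> forces
    \<open>r' = 1\<close>.\<close>
  have "g ^ s * (r' ^ s * (g ^ s * k' ^ s)) dvd g ^ s * (a * k' ^ s + b * r' ^ s)"
    using assms(5) by (simp add: rk power_mult_distrib algebra_simps)
  hence "r' ^ s * (g ^ s * k' ^ s) dvd a * k' ^ s + b * r' ^ s"
    using g by simp
  hence "r' ^ s dvd a * k' ^ s + b * r' ^ s"
    by (rule dvd_mult_left)
  hence "r' ^ s dvd a * k' ^ s"
    by (simp add: dvd_add_left_iff)
  moreover have "coprime (r' ^ s) (k' ^ s)"
    using rk(3) by simp
  ultimately have "r' ^ s dvd a"
    by (simp add: coprime_dvd_mult_left_iff)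
  moreover have "r' dvd r"
    by (simp add: rk(1))
  ultimately have "r' = 1"
    using assms(4) by (auto simp: primitive_residues_def)
  thus ?thesis by (simp add: rk)
qed

text \<open>Negation modulo \<open>r ^ s\<close> preserves primitivity, since \<open>l ^ s\<close>
  divides \<open>r ^ s\<close> for every divisor \<open>l\<close> of \<open>r\<close>. For equal
  moduli this pairs each \<open>b\<close> with the single \<open>a\<close> whose root of unity is
  inverse to that of \<open>b\<close>.\<close>

lemma primitive_residues_ex1_neg:
  assumes "s > 0" "r > 0" "b \<in> primitive_residues s r"
  shows "\<exists>!a. a \<in> primitive_residues s r \<and> r ^ s dvd a + b"
proof -
  define R where "R = r ^ s"
  have b: "1 \<le> b" "b \<le> R" "\<And>l. l dvd r \<Longrightarrow> l ^ s dvd b \<Longrightarrow> l = 1"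
    using assms(3) by (auto simp: primitive_residues_def R_def)
  have dvdR: "l ^ s dvd R" if "l dvd r" for l
    using that by (simp add: R_def dvd_power_same)
  \<comment> \<open>\<open>b = R\<close> occurs only for \<open>r = 1\<close>; then \<open>R - b = 0\<close> lies outside \<open>{1..R}\<close>.\<close>
  define a where "a = (if b = R then R else R - b)"
  show ?thesis
  proof (rule ex1I[of _ a])
    have "a \<in> primitive_residues s r"
    proof (cases "b = R")
      case True
      thus ?thesis using assms(3) by (simp add: a_def)
    next
      case False
      have "l = 1" if "l dvd r" "l ^ s dvd R - b" for l
      proof (rule b(3))
        show "l ^ s dvd b"
          using that dvdR[OF that(1)] b(2) by (metis dvd_diffD1)
      qed fact
      thus ?thesis
        using False b(1,2) by (auto simp: primitive_residues_def a_def R_def)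
    qed
    moreover have "R dvd a + b"
      using b(2) by (auto simp: a_def)
    ultimately show "a \<in> primitive_residues s r \<and> r ^ s dvd a + b"
      by (simp add: R_def)
  next
    fix a' assume a': "a' \<in> primitive_residues s r \<and> r ^ s dvd a' + b"
    hence a'': "1 \<le> a'" "a' \<le> R" "R dvd a' + b"
      by (auto simp: primitive_residues_def R_def)
    \<comment> \<open>The sum \<open>a' + b\<close> is a positive multiple of \<open>R\<close> and
      at most \<open>2 * R\<close>. The value \<open>2 * R\<close> occurs only if both terms equal
      \<open>R\<close>.\<close>
    then obtain t where t: "a' + b = R * t" by (auto elim: dvdE)
    have "R > 0" using b by simp
    moreover have "0 < R * t" "R * t \<le> R * 2"
      using t a'' b by linarith+
    ultimately have "t > 0" "t \<le> 2"
      by simp_all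
    hence "t = 1 \<or> t = 2"
      by linarith
    thus "a' = a"
      using t a'' b by (auto simp: a_def)
  qed
qed

text \<open>The mean of \<open>(u a * v b) ^ n\<close> survives in the limit only for pairs with
  \<open>u a * v b = 1\<close>. No such pair exists for distinct moduli; for equal moduli each
  \<open>b\<close> has one partner, and the weights \<open>v b ^ h\<close> add up to the sum at
  \<open>h\<close>.\<close>

lemma tendsto_mean_cohen_ramanujan_product:
  assumes "s > 0" "r > 0" "k > 0"
  shows "(\<lambda>N. (\<Sum>n=1..N. cohen_ramanujan_sum s r (int n) * cohen_ramanujan_sum s k (int (n + h))) / of_nat N)
           \<longlonglongrightarrow> (if r = k then cohen_ramanujan_sum s r (int h) else 0)"
proof -
  define u where "u = (\<lambda>a. turn (real a / real (r ^ s)))"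
  define v where "v = (\<lambda>b. turn (real b / real (k ^ s)))"
  define A where "A = primitive_residues s r"
  define B where "B = primitive_residues s k"
  have [simp]: "finite A" "finite B" by (simp_all add: A_def B_def)
  \<comment> \<open>The shift contributes a weight depending on \<open>b\<close> alone, so
    \<open>b\<close> is summed outermost and the inner sum counts its partners
    \<open>a\<close>.\<close>
  have prod_eq: "cohen_ramanujan_sum s r (int n) * cohen_ramanujan_sum s k (int (n + h)) =
     (\<Sum>b\<in>B. \<Sum>a\<in>A. v b ^ h * (u a * v b) ^ n)" for n
  proof -
    have "cohen_ramanujan_sum s r (int n) = (\<Sum>a\<in>A. u a ^ n)"
      "cohen_ramanujan_sum s k (int (n + h)) = (\<Sum>b\<in>B. v b ^ (n + h))"
      using assms by (simp_all only: cohen_ramanujan_sum_eq A_def B_def u_def v_def)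
    hence "cohen_ramanujan_sum s r (int n) * cohen_ramanujan_sum s k (int (n + h)) =
       (\<Sum>a\<in>A. \<Sum>b\<in>B. u a ^ n * v b ^ (n + h))"
      by (simp only: sum_product)
    also have "\<dots> = (\<Sum>b\<in>B. \<Sum>a\<in>A. u a ^ n * v b ^ (n + h))"
      by (rule sum.swap)
    finally show ?thesis
      by (simp add: power_add power_mult_distrib mult_ac)
  qed
  have eq: "(\<Sum>n=1..N. cohen_ramanujan_sum s r (int n) * cohen_ramanujan_sum s k (int (n + h))) / of_nat N =
     (\<Sum>b\<in>B. \<Sum>a\<in>A. v b ^ h * ((\<Sum>n=1..N. (u a * v b) ^ n) / of_nat N))" for N
  proof -
    have "(\<Sum>n=1..N. cohen_ramanujan_sum s r (int n) * cohen_ramanujan_sum s k (int (n + h))) =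
       (\<Sum>b\<in>B. \<Sum>n=1..N. \<Sum>a\<in>A. v b ^ h * (u a * v b) ^ n)"
      by (simp only: prod_eq, rule sum.swap)
    also have "\<dots> = (\<Sum>b\<in>B. \<Sum>a\<in>A. \<Sum>n=1..N. v b ^ h * (u a * v b) ^ n)"
      by (intro sum.cong refl sum.swap)
    finally show ?thesis
      by (simp add: sum_distrib_left sum_divide_distrib)
  qed
  have "(\<lambda>N. \<Sum>b\<in>B. \<Sum>a\<in>A. v b ^ h * ((\<Sum>n=1..N. (u a * v b) ^ n) / of_nat N))
      \<longlonglongrightarrow> (\<Sum>b\<in>B. \<Sum>a\<in>A. v b ^ h * of_bool (u a * v b = 1))"
    by (intro tendsto_sum tendsto_mult tendsto_const tendsto_mean_power)
       (simp add: u_def v_def norm_mult)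
  also have "(\<Sum>b\<in>B. \<Sum>a\<in>A. v b ^ h * of_bool (u a * v b = 1)) =
      (if r = k then cohen_ramanujan_sum s r (int h) else 0)"
  proof (cases "r = k")
    case True
    have "(\<Sum>b\<in>B. \<Sum>a\<in>A. v b ^ h * of_bool (u a * v b = 1)) = (\<Sum>b\<in>B. v b ^ h)"
    proof (rule sum.cong)
      fix b assume b: "b \<in> B"
      hence b': "b \<in> primitive_residues s r" by (simp add: B_def True)
      obtain a0 where a0: "a0 \<in> A" "\<And>a. a \<in> A \<Longrightarrow> r ^ s dvd a + b \<longleftrightarrow> a = a0"
        using primitive_residues_ex1_neg[OF assms(1,2) b'] unfolding A_def by metis
      have "u a * v b = 1 \<longleftrightarrow> r ^ s dvd a + b" for a
      proof -
        have "a * r ^ s + b * r ^ s = r ^ s * (a + b)"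
          by (simp add: algebra_simps)
        moreover have "u a * v b = 1 \<longleftrightarrow> r ^ s * r ^ s dvd a * r ^ s + b * r ^ s"
          unfolding u_def v_def using True assms by (subst turn_mult_eq_1_iff) auto
        ultimately show ?thesis using assms by simp
      qed
      hence "(\<Sum>a\<in>A. v b ^ h * of_bool (u a * v b = 1)) = (\<Sum>a\<in>A. if a = a0 then v b ^ h else 0)"
        using a0(2) by (intro sum.cong) auto
      thus "(\<Sum>a\<in>A. v b ^ h * of_bool (u a * v b = 1)) = v b ^ h"
        using a0(1) by simp
    qed auto
    thus ?thesis
      using assms by (simp add: True cohen_ramanujan_sum_eq B_def v_def)
  next
    case False
    have "u a * v b \<noteq> 1" if "a \<in> A" "b \<in> B" for a b
    proof
      assume "u a * v b = 1"
      hence *: "r ^ s * k ^ s dvd a * k ^ s + b * r ^ s"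
        unfolding u_def v_def using assms by (subst (asm) turn_mult_eq_1_iff) auto
      have "r dvd k"
        using primitive_residues_dvd[OF assms _ *] that by (simp add: A_def)
      moreover have "k dvd r"
        using primitive_residues_dvd[of s k r b a] * assms that by (simp add: B_def add.commute mult.commute)
      ultimately show False
        using False by (simp add: dvd_antisym)
    qed
    thus ?thesis using False by simp
  qed
  finally show ?thesis by (simp only: eq)
qed

section \<open>Limits and products of unordered sums\<close>

text \<open>Dominated convergence for series: a finite \<open>X\<close> carries almost all of the
  mass of \<open>M\<close>, which controls both tails at once, and on \<open>X\<close> termwise
  convergence suffices.\<close>

lemma tannery_infsum:
  fixes a :: "'i \<Rightarrow> 'n \<Rightarrow> 'b :: banach"
  assumes "\<And>k. k \<in> A \<Longrightarrow> ((\<lambda>n. a k n) \<longlongrightarrow> b k) F"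
    and bound: "eventually (\<lambda>n. \<forall>k\<in>A. norm (a k n) \<le> M k) F"
    and M: "M summable_on A" and "F \<noteq> bot"
  shows "((\<lambda>n. infsum (\<lambda>k. a k n) A) \<longlongrightarrow> infsum b A) F"
proof (rule tendstoI)
  fix e :: real assume "e > 0"
  \<comment> \<open>The bound passes to the limit, so the tail estimate applies to \<open>b\<close>
    too.\<close>
  have bb: "norm (b k) \<le> M k" if "k \<in> A" for k
  proof (rule tendsto_le[OF \<open>F \<noteq> bot\<close> tendsto_const tendsto_norm[OF assms(1)[OF that]]])
    show "eventually (\<lambda>n. norm (a k n) \<le> M k) F"
      using bound by eventually_elim (use that in auto)
  qed
  \<comment> \<open>Two tails and one finite difference, each at most \<open>e / 4\<close>, stay
    below \<open>e\<close>.\<close>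
  obtain X where X: "finite X" "X \<subseteq> A" "dist (sum M X) (infsum M A) \<le> e / 4"
    using infsum_finite_approximation[OF M, of "e / 4"] \<open>e > 0\<close> by auto
  have tail: "norm (infsum c A - sum c X) \<le> e / 4" if "\<And>k. k \<in> A \<Longrightarrow> norm (c k) \<le> M k" for c :: "'i \<Rightarrow> 'b"
  proof -
    have "(\<lambda>k. norm (c k)) summable_on A"
      by (rule summable_on_comparison_test[OF M]) (use that in auto)
    hence c: "c summable_on A"
      by (rule abs_summable_summable)
    have "(c has_sum infsum c A - sum c X) (A - X)"
      using X c by (intro has_sum_Diff has_sum_infsum) auto
    moreover have "(M has_sum infsum M A - sum M X) (A - X)"
      using X M by (intro has_sum_Diff has_sum_infsum) auto
    ultimately have "norm (infsum c A - sum c X) \<le> infsum M A - sum M X"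
      by (rule norm_infsum_le) (use that in auto)
    also have "\<dots> \<le> e / 4"
      using X(3) unfolding dist_real_def by linarith
    finally show ?thesis .
  qed
  have "((\<lambda>n. \<Sum>k\<in>X. a k n) \<longlongrightarrow> sum b X) F"
    using X by (intro tendsto_sum assms(1)) auto
  hence "eventually (\<lambda>n. dist (\<Sum>k\<in>X. a k n) (sum b X) < e / 4) F"
    using \<open>e > 0\<close> by (intro tendstoD) auto
  with bound show "eventually (\<lambda>n. dist (infsum (\<lambda>k. a k n) A) (infsum b A) < e) F"
  proof eventually_elim
    case (elim n)
    have "dist (infsum (\<lambda>k. a k n) A) (\<Sum>k\<in>X. a k n) \<le> e / 4"
      using tail[of "\<lambda>k. a k n"] elim by (simp add: dist_norm)
    moreover have "dist (sum b X) (infsum b A) \<le> e / 4"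
      using tail[of b] bb by (simp add: dist_norm norm_minus_commute)
    moreover have "dist (infsum (\<lambda>k. a k n) A) (infsum b A) \<le> 
       dist (infsum (\<lambda>k. a k n) A) (\<Sum>k\<in>X. a k n) + dist (\<Sum>k\<in>X. a k n) (sum b X) + dist (sum b X) (infsum b A)"
      by metric
    ultimately show ?case using elim \<open>e > 0\<close> by linarith
  qed
qed

lemma has_sum_finite_sum:
  fixes f :: "'i \<Rightarrow> 'a \<Rightarrow> 'b :: topological_comm_monoid_add"
  assumes "\<And>i. i \<in> I \<Longrightarrow> (f i has_sum x i) A"
  shows "((\<lambda>a. \<Sum>i\<in>I. f i a) has_sum (\<Sum>i\<in>I. x i)) A"
  \<comment> \<open>For infinite \<open>I\<close> both sums over \<open>I\<close> are 0 by
    convention.\<close>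
  using assms by (induction I rule: infinite_finite_induct) (auto intro: has_sum_add)

text \<open>Absolute convergence of both factors makes the product family absolutely summable on the
  rectangle; its value is then found by iterated summation.\<close>

lemma has_sum_product:
  fixes f :: "'a \<Rightarrow> 'c :: {banach, real_normed_div_algebra}" and g :: "'b \<Rightarrow> 'c"
  assumes "(f has_sum x) A" "(g has_sum y) B"
    and "(\<lambda>a. norm (f a)) summable_on A" "(\<lambda>b. norm (g b)) summable_on B"
  shows "((\<lambda>(a, b). f a * g b) has_sum x * y) (A \<times> B)"
proof (rule has_sum_SigmaI)
  have "(\<lambda>z. norm ((\<lambda>(a, b). f a * g b) z)) summable_on A \<times> B"
  proof (rule summable_on_SigmaI)
    show "((\<lambda>b. norm ((\<lambda>(a, b). f a * g b) (a, b))) has_sum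
        norm (f a) * infsum (\<lambda>b. norm (g b)) B) B" for a
      using assms(4) by (auto simp: norm_mult intro!: has_sum_cmult_right)
    show "(\<lambda>a. norm (f a) * infsum (\<lambda>b. norm (g b)) B) summable_on A"
      by (rule summable_on_cmult_left[OF assms(3)])
  qed auto
  thus "(\<lambda>(a, b). f a * g b) summable_on A \<times> B"
    by (rule abs_summable_summable)
  show "((\<lambda>b. (\<lambda>(a, b). f a * g b) (a, b)) has_sum f a * y) B" for a
    using assms(2) by (auto intro: has_sum_cmult_right)
  show "((\<lambda>a. f a * y) has_sum x * y) A"
    using assms(1) by (rule has_sum_cmult_left)
qed

section \<open>Passage to the limit under the double series\<close>

text \<open>Both cases express that \<open>A N / N\<close> tends to \<open>C\<close>. For
  \<open>C = 0\<close> a ratio to \<open>N * C\<close> carries no information, so the limit is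
  stated as \<open>A\<close> being of smaller order than \<open>N\<close>.\<close>

theorem theorem1p2:
  fixes s h :: nat and f g fhat ghat :: "nat \<Rightarrow> complex"
  assumes "s > 0"
    and "has_abs_cohen_ramanujan_expansion s f fhat"
    and "has_abs_cohen_ramanujan_expansion s g ghat"
    and "(\<lambda>(r, k). norm (fhat r) * norm (ghat k) * sqrt (real (r ^ s * k ^ s))
            * real (tau s (r ^ s)) * real (tau s (k ^ s))) summable_on ({1..} \<times> {1..})"
  shows "let C = (\<Sum>\<^sub>\<infinity>r\<in>{1..}. fhat r * ghat r * cohen_ramanujan_sum s r (int h));
             A = (\<lambda>N::nat. \<Sum>n = 1..N. f n * g (n + h))
         in (C \<noteq> 0 \<longrightarrow> A \<sim>[at_top] (\<lambda>N. of_nat N * C)) \<and>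
            (C = 0 \<longrightarrow> A \<in> o[at_top](\<lambda>N. of_nat N))"
proof -
  define C where "C = (\<Sum>\<^sub>\<infinity>r\<in>{1..}. fhat r * ghat r * cohen_ramanujan_sum s r (int h))"
  define A where "A = (\<lambda>N::nat. \<Sum>n = 1..N. f n * g (n + h))"
  define I where "I = ({1..} :: nat set)"
  define c where "c = cohen_ramanujan_sum s"
  define S where "S = (\<lambda>r k N. \<Sum>n=1..N. c r (int n) * c k (int (n + h)))"
  define a where "a = (\<lambda>(r, k) N. fhat r * ghat k * (S r k N / of_nat N))"
  define b where "b = (\<lambda>(r, k). fhat r * ghat k * (if r = k then c r (int h) else 0))"
  define M where "M = (\<lambda>(r, k). norm (fhat r) * norm (ghat k) * sqrt (real (r ^ s * k ^ s))
            * real (tau s (r ^ s)) * real (tau s (k ^ s)))"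
  have M: "M summable_on I \<times> I"
    using assms(4) by (simp add: M_def I_def)

  have "(\<lambda>N. infsum (\<lambda>p. a p N) (I \<times> I)) \<longlonglongrightarrow> infsum b (I \<times> I)"
  proof (rule tannery_infsum)
    fix p assume "p \<in> I \<times> I"
    then obtain r k where p: "p = (r, k)" "r > 0" "k > 0"
      by (auto simp: I_def)
    show "a p \<longlonglongrightarrow> b p"
      unfolding p a_def b_def S_def c_def prod.case
      by (intro tendsto_mult tendsto_const tendsto_mean_cohen_ramanujan_product assms p)
  next
    \<comment> \<open>The constant comes from \<open>N + h \<le> N * (1 + h)\<close>, valid for
      \<open>N \<ge> 1\<close>.\<close>
    show "eventually (\<lambda>N. \<forall>p\<in>I \<times> I. norm (a p N) \<le> (1 + real h) * M p) sequentially"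
      using eventually_gt_at_top[of 0]
    proof eventually_elim
      case (elim N)
      show ?case
      proof clarify
        fix r k assume "r \<in> I" "k \<in> I"
        define q where "q = sqrt (real (r ^ s * k ^ s)) * real (tau s (r ^ s)) * real (tau s (k ^ s))"
        have "q \<ge> 0" by (simp add: q_def)
        have "norm (S r k N) \<le> real (N + h) * q"
          unfolding S_def c_def q_def
          using norm_sum_cohen_ramanujan_product_le assms(1) \<open>r \<in> I\<close> \<open>k \<in> I\<close> by (simp add: I_def)
        also have "real (N + h) \<le> real N * (1 + real h)"
          using elim mult_right_mono[of 1 "real N" "real h"] by (simp add: algebra_simps)
        finally have "norm (S r k N / of_nat N) \<le> (1 + real h) * q"
          using elim \<open>q \<ge> 0\<close> by (simp add: norm_divide field_simps mult_right_mono)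
        hence "norm (fhat r * ghat k) * norm (S r k N / of_nat N) \<le> norm (fhat r * ghat k) * ((1 + real h) * q)"
          by (rule mult_left_mono) auto
        thus "norm (a (r, k) N) \<le> (1 + real h) * M (r, k)"
          by (simp add: a_def M_def q_def norm_mult norm_divide mult_ac)
      qed
    qed
    show "(\<lambda>p. (1 + real h) * M p) summable_on I \<times> I"
      using M by (rule summable_on_cmult_right)
  qed auto
  \<comment> \<open>Orthogonality makes \<open>b\<close> vanish off the diagonal, which leaves a
    single series over \<open>r\<close>.\<close>
  also have "infsum b (I \<times> I) = infsum b ((\<lambda>r. (r, r)) ` I)"
    by (rule infsum_cong_neutral) (auto simp: b_def)
  also have "\<dots> = C"
    by (subst infsum_reindex) (auto simp: C_def I_def b_def c_def o_def inj_on_def)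
  finally have lim: "(\<lambda>N. infsum (\<lambda>p. a p N) (I \<times> I)) \<longlonglongrightarrow> C" .

  \<comment> \<open>Both \<open>n\<close> and \<open>n + h\<close> are positive for \<open>n\<close>
    in \<open>{1..N}\<close>, so the expansions apply and can be multiplied; the finite sum over
    \<open>n\<close> then moves inside the double series. At \<open>N = 0\<close> both sides are
    0.\<close>
  have "infsum (\<lambda>p. a p N) (I \<times> I) = A N / of_nat N" for N
  proof (rule infsumI)
    have "((\<lambda>(r, k). (fhat r * c r (int n)) * (ghat k * c k (int (n + h)))) has_sum f n * g (n + h)) (I \<times> I)"
      if "n \<in> {1..N}" for n
      using assms(2,3) that unfolding I_def c_def
      by (intro has_sum_product) (auto simp: has_abs_cohen_ramanujan_expansion_def simp del: of_nat_add)
    hence "((\<lambda>p. \<Sum>n=1..N. (\<lambda>(r, k). (fhat r * c r (int n)) * (ghat k * c k (int (n + h)))) p) has_sum A N) (I \<times> I)"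
      unfolding A_def by (rule has_sum_finite_sum)
    hence "((\<lambda>p. (\<Sum>n=1..N. (\<lambda>(r, k). (fhat r * c r (int n)) * (ghat k * c k (int (n + h)))) p) * inverse (of_nat N))
        has_sum A N * inverse (of_nat N)) (I \<times> I)"
      by (rule has_sum_cmult_left)
    moreover have "(\<lambda>p. (\<Sum>n=1..N. (\<lambda>(r, k). (fhat r * c r (int n)) * (ghat k * c k (int (n + h)))) p) * inverse (of_nat N))
       = (\<lambda>p. a p N)"
      by (auto simp: a_def S_def sum_distrib_left sum_divide_distrib fun_eq_iff field_simps)
    ultimately show "((\<lambda>p. a p N) has_sum A N / of_nat N) (I \<times> I)"
      by (simp add: divide_inverse)
  qed
  hence lim: "(\<lambda>N. A N / of_nat N) \<longlonglongrightarrow> C"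
    using lim by simp

  have "A \<sim>[at_top] (\<lambda>N. of_nat N * C)" if "C \<noteq> 0"
  proof (rule asymp_equivI')
    have "(\<lambda>N. A N / of_nat N / C) \<longlonglongrightarrow> C / C"
      using lim that by (intro tendsto_divide tendsto_const) auto
    thus "(\<lambda>N. A N / (of_nat N * C)) \<longlonglongrightarrow> 1"
      using that by simp
  qed
  moreover have "A \<in> o[at_top](\<lambda>N. of_nat N)" if "C = 0"
  proof (rule smalloI_tendsto)
    show "(\<lambda>N. A N / of_nat N) \<longlonglongrightarrow> 0"
      using lim that by simp
    show "eventually (\<lambda>N. of_nat N \<noteq> (0 :: complex)) at_top"
      using eventually_gt_at_top[of 0] by eventually_elim simp
  qed
  ultimately show ?thesis
    unfolding Let_def C_def[symmetric] A_def[symmetric] by blast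
qed

end
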